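(* Let $q>1$ and $n\ge2$. The short systematic scan $K$ and the $q$-deformed $k$-star transposition shuffle $P$ at $k=1$ are both affine functions of the single Jucys--Murphy element $J_n(q)$ in $\mathcal H_q(S_n)$: $$P\big|_{k=1}=\frac{I+q\,J_n(q)}{[n]_q},\qquad K=q^{1-n}\bigl(I+(q-1)J_n(q)\bigr).$$ For $\lambda\vdash n$ and $S\in\mathrm{SYT}(\lambda)$, write $c=c_n(S)$. The corresponding eigenvalues (on the seminormal basis vector $v_S$ of $S_q^\lambda$) satisfy $$\mathrm{eig}_q^{P|_{k=1}}(S)=\frac{[c+1]_q}{[n]_q},\qquad\mathrm{eig}_q^{K}(S)=q^{c+1-n}.$$
   Context: For $r\in\mathbb Z$, $[r]_q=\frac{q^r-1}{q-1}$. $\mathcal H_q(S_n)$ is the complex algebra (unit $I$) generated by $T_{s_1},\dots,T_{s_{n-1}}$, $s_i=(i\ i+1)$, with $T_{s_i}^2=(q-1)T_{s_i}+q$, $T_{s_i}T_{s_j}=T_{s_j}T_{s_i}$ for $|i-j|\ge2$, and $T_{s_i}T_{s_{i+1}}T_{s_i}=T_{s_{i+1}}T_{s_i}T_{s_{i+1}}$; $T_w=T_{s_{i_1}}\cdots T_{s_{i_r}}$ for a reduced expression of $w$; $\ell(w)$ is the number of inversions of $w$ and $\widetilde T_w=q^{-\ell(w)}T_w$. Jucys--Murphy elements: $J_m(q)=\sum_{i=1}^{m-1}q^{m-1-i}\widetilde T_{(i\,m)}$, $2\le m\le n$. $P=\frac{1}{[n]_q}I+\frac{q[n-1]_q}{[n]_q\sum_{l=1}^{k}[n-l]_q}\sum_{l=1}^{k}J_{n+1-l}(q)$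 for $1\le k\le n-1$, and $K=\widetilde T_{s_{n-1}}\cdots\widetilde T_{s_2}\widetilde T_{s_1}^2\widetilde T_{s_2}\cdots\widetilde T_{s_{n-1}}$. $\mathrm{SYT}(\lambda)$ is the set of standard Young tableaux of shape $\lambda$, and $c_m(S)=j-i$ if the entry $m$ lies in row $i$ and column $j$ of $S$. The irreducible module $S_q^\lambda$ of $\mathcal H_q(S_n)$ has a seminormal basis $\{v_S:S\in\mathrm{SYT}(\lambda)\}$ with $J_m(q)v_S=[c_m(S)]_qv_S$ for $2\le m\le n$. *)

theory Defs
  imports
    Complex_Main
    "HOL-Library.Poly_Mapping"
    "HOL-Combinatorics.Permutations"
    "HOL-Algebra.QuotRing"
    "HOL-Algebra.Module"
begin

definition qint :: "complex \<Rightarrow> int \<Rightarrow> complex" where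
  "qint q r = (q powi r - 1) / (q - 1)"


section \<open>The Hecke algebra of type A by generators and relations\<close>

text \<open>
  Words in the letters \<open>0, 1, 2, \<dots>\<close> form the free monoid, written additively so that
  \<open>gen_word \<Rightarrow>\<^sub>0 complex\<close> carries the convolution product of \<^theory>\<open>HOL-Library.Poly_Mapping\<close>,
  i.e. it is the free associative algebra on countably many generators.
\<close>

datatype gen_word = Gen_Word (letters: "nat list")

instantiation gen_word :: monoid_add
begin

definition zero_gen_word :: gen_word where
  "0 = Gen_Word []"

definition plus_gen_word :: "gen_word \<Rightarrow> gen_word \<Rightarrow> gen_word" where
  "u + v = Gen_Word (letters u @ letters v)"

instance
  by standard (simp_all add: zero_gen_word_def plus_gen_word_def)

end

text \<open>The free complex algebra on the generators with index in \<open>{1..<n}\<close>.\<close>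

definition free_alg :: "nat \<Rightarrow> (complex, gen_word \<Rightarrow>\<^sub>0 complex) module" where
  "free_alg n = \<lparr>
     carrier = {f. \<forall>w \<in> Poly_Mapping.keys f. set (letters w) \<subseteq> {1..<n}},
     monoid.mult = (*),
     one = 1,
     ring.zero = 0,
     add = (+),
     smult = (\<lambda>c f. Poly_Mapping.single 0 c * f) \<rparr>"

definition fgen :: "nat \<Rightarrow> gen_word \<Rightarrow>\<^sub>0 complex" where
  "fgen i = Poly_Mapping.single (Gen_Word [i]) 1"

definition fconst :: "complex \<Rightarrow> gen_word \<Rightarrow>\<^sub>0 complex" where
  "fconst c = Poly_Mapping.single 0 c"

definition hecke_rels :: "complex \<Rightarrow> nat \<Rightarrow> (gen_word \<Rightarrow>\<^sub>0 complex) set" where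
  "hecke_rels q n =
     {fgen i * fgen i - (fconst (q - 1) * fgen i + fconst q) | i. i \<in> {1..<n}} \<union>
     {fgen i * fgen j - fgen j * fgen i | i j.
        i \<in> {1..<n} \<and> j \<in> {1..<n} \<and> \<bar>int i - int j\<bar> \<ge> 2} \<union>
     {fgen i * fgen (i + 1) * fgen i - fgen (i + 1) * fgen i * fgen (i + 1) | i.
        i \<in> {1..<n} \<and> i + 1 \<in> {1..<n}}"

definition hecke_ideal :: "complex \<Rightarrow> nat \<Rightarrow> (gen_word \<Rightarrow>\<^sub>0 complex) set" where
  "hecke_ideal q n = Idl\<^bsub>free_alg n\<^esub> (hecke_rels q n)"

text \<open>
  The algebra \<open>H\<^sub>q(S\<^sub>n)\<close>: the quotient ring by the two-sided ideal generated by the relations,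
  with the induced scalar multiplication (a union of equal cosets, in the style of
  \<^const>\<open>rcoset_mult\<close>).
\<close>

definition hecke_alg :: "complex \<Rightarrow> nat \<Rightarrow> (complex, (gen_word \<Rightarrow>\<^sub>0 complex) set) module" where
  "hecke_alg q n =
     ring.extend (free_alg n Quot hecke_ideal q n)
       (module.fields (\<lambda>c X. \<Union>x\<in>X. hecke_ideal q n +>\<^bsub>free_alg n\<^esub> (c \<odot>\<^bsub>free_alg n\<^esub> x)))"

definition hecke_gen :: "complex \<Rightarrow> nat \<Rightarrow> nat \<Rightarrow> (gen_word \<Rightarrow>\<^sub>0 complex) set" where
  "hecke_gen q n i = hecke_ideal q n +>\<^bsub>free_alg n\<^esub> fgen i"

definition list_mult :: "('a, 'b) monoid_scheme \<Rightarrow> 'a list \<Rightarrow> 'a" where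
  "list_mult G xs = foldr (\<lambda>x y. x \<otimes>\<^bsub>G\<^esub> y) xs \<one>\<^bsub>G\<^esub>"


section \<open>The elements \<open>T\<^sub>w\<close>, Jucys--Murphy elements and the two shuffles\<close>

definition perm_of_word :: "nat list \<Rightarrow> nat \<Rightarrow> nat" where
  "perm_of_word is = foldr (\<lambda>i w. transpose i (i + 1) \<circ> w) is id"

definition reduced_word :: "nat \<Rightarrow> (nat \<Rightarrow> nat) \<Rightarrow> nat list \<Rightarrow> bool" where
  "reduced_word n w is \<longleftrightarrow>
     set is \<subseteq> {1..<n} \<and> perm_of_word is = w \<and>
     (\<forall>js. set js \<subseteq> {1..<n} \<and> perm_of_word js = w \<longrightarrow> length is \<le> length js)"

definition inversions :: "nat \<Rightarrow> (nat \<Rightarrow> nat) \<Rightarrow> nat" where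
  "inversions n w = card {(i, j). 1 \<le> i \<and> i < j \<and> j \<le> n \<and> w j < w i}"

text \<open>The value does not depend on the chosen reduced word, by Matsumoto's theorem.\<close>

definition hecke_T :: "complex \<Rightarrow> nat \<Rightarrow> (nat \<Rightarrow> nat) \<Rightarrow> (gen_word \<Rightarrow>\<^sub>0 complex) set" where
  "hecke_T q n w = list_mult (hecke_alg q n) (map (hecke_gen q n) (SOME is. reduced_word n w is))"

definition hecke_Ttilde :: "complex \<Rightarrow> nat \<Rightarrow> (nat \<Rightarrow> nat) \<Rightarrow> (gen_word \<Rightarrow>\<^sub>0 complex) set" where
  "hecke_Ttilde q n w = (q powi (- int (inversions n w))) \<odot>\<^bsub>hecke_alg q n\<^esub> hecke_T q n w"

definition jucys_murphy :: "complex \<Rightarrow> nat \<Rightarrow> nat \<Rightarrow> (gen_word \<Rightarrow>\<^sub>0 complex) set" where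
  "jucys_murphy q n m =
     (\<Oplus>\<^bsub>hecke_alg q n\<^esub>i\<in>{1..<m}. q ^ (m - 1 - i) \<odot>\<^bsub>hecke_alg q n\<^esub> hecke_Ttilde q n (transpose i m))"

definition star_shuffle :: "complex \<Rightarrow> nat \<Rightarrow> nat \<Rightarrow> (gen_word \<Rightarrow>\<^sub>0 complex) set" where
  "star_shuffle q n k =
     (1 / qint q (int n)) \<odot>\<^bsub>hecke_alg q n\<^esub> \<one>\<^bsub>hecke_alg q n\<^esub> \<oplus>\<^bsub>hecke_alg q n\<^esub>
     (q * qint q (int n - 1) / (qint q (int n) * (\<Sum>l = 1..k. qint q (int n - int l))))
       \<odot>\<^bsub>hecke_alg q n\<^esub> (\<Oplus>\<^bsub>hecke_alg q n\<^esub>l\<in>{1..k}. jucys_murphy q n (n + 1 - l))"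

text \<open>The factors of \<open>K\<close> are indexed by \<open>n-1, \<dots>, 2, 1, 1, 2, \<dots>, n-1\<close>.\<close>

definition short_scan :: "complex \<Rightarrow> nat \<Rightarrow> (gen_word \<Rightarrow>\<^sub>0 complex) set" where
  "short_scan q n =
     list_mult (hecke_alg q n)
       (map (\<lambda>i. hecke_Ttilde q n (transpose i (i + 1))) (rev [1..<n] @ [1..<n]))"


section \<open>Standard Young tableaux\<close>

definition is_partition :: "nat list \<Rightarrow> nat \<Rightarrow> bool" where
  "is_partition lam n \<longleftrightarrow> sorted_wrt (\<ge>) lam \<and> 0 \<notin> set lam \<and> sum_list lam = n"

text \<open>Cells are pairs (row, column), both counted from 1.\<close>

definition young_diagram :: "nat list \<Rightarrow> (nat \<times> nat) set" where
  "young_diagram lam = {(i, j). 1 \<le> i \<and> i \<le> length lam \<and> 1 \<le> j \<and> j \<le> lam ! (i - 1)}"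

text \<open>A tableau is a filling of the cells, extended by 0 outside the diagram.\<close>

definition SYT :: "nat list \<Rightarrow> (nat \<times> nat \<Rightarrow> nat) set" where
  "SYT lam = {S.
     bij_betw S (young_diagram lam) {1..sum_list lam} \<and>
     (\<forall>p. p \<notin> young_diagram lam \<longrightarrow> S p = 0) \<and>
     (\<forall>i j j'. (i, j) \<in> young_diagram lam \<and> (i, j') \<in> young_diagram lam \<and> j < j' \<longrightarrow>
        S (i, j) < S (i, j')) \<and>
     (\<forall>i i' j. (i, j) \<in> young_diagram lam \<and> (i', j) \<in> young_diagram lam \<and> i < i' \<longrightarrow>
        S (i, j) < S (i', j))}"

definition content :: "nat \<Rightarrow> (nat \<times> nat \<Rightarrow> nat) \<Rightarrow> int" where
  "content m S = (case THE p. S p = m of (i, j) \<Rightarrow> int j - int i)"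


section \<open>Modules over the Hecke algebra and seminormal bases\<close>

locale hecke_module = vector_space scale
  for scale :: "complex \<Rightarrow> 'v::ab_group_add \<Rightarrow> 'v" +
  fixes q :: complex and n :: nat
    and act :: "(gen_word \<Rightarrow>\<^sub>0 complex) set \<Rightarrow> 'v \<Rightarrow> 'v"
  assumes act_linear: "a \<in> carrier (hecke_alg q n) \<Longrightarrow> Vector_Spaces.linear scale scale (act a)"
    and act_one: "act \<one>\<^bsub>hecke_alg q n\<^esub> x = x"
    and act_mult: "a \<in> carrier (hecke_alg q n) \<Longrightarrow> b \<in> carrier (hecke_alg q n) \<Longrightarrow>
          act (a \<otimes>\<^bsub>hecke_alg q n\<^esub> b) x = act a (act b x)"
    and act_add: "a \<in> carrier (hecke_alg q n) \<Longrightarrow> b \<in> carrier (hecke_alg q n) \<Longrightarrow>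
          act (a \<oplus>\<^bsub>hecke_alg q n\<^esub> b) x = act a x + act b x"
    and act_smult: "a \<in> carrier (hecke_alg q n) \<Longrightarrow>
          act (c \<odot>\<^bsub>hecke_alg q n\<^esub> a) x = scale c (act a x)"

locale irreducible_hecke_module = hecke_module scale q n act
  for scale :: "complex \<Rightarrow> 'v::ab_group_add \<Rightarrow> 'v" and q n act +
  assumes nontrivial: "\<exists>x::'v. x \<noteq> 0"
    and irreducible: "subspace W \<Longrightarrow>
          (\<And>a x. a \<in> carrier (hecke_alg q n) \<Longrightarrow> x \<in> W \<Longrightarrow> act a x \<in> W) \<Longrightarrow>
          W = {0} \<or> W = UNIV"

text \<open>
  The module \<open>S\<^sub>q\<^sup>\<lambda>\<close> together with a seminormal basis \<open>v\<close>.  For \<open>q > 1\<close> the Jucys--Murphy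
  eigenvalues determine the irreducible module up to isomorphism and each \<open>v S\<close> up to a scalar.
\<close>

locale seminormal_module = irreducible_hecke_module scale q n act
  for scale :: "complex \<Rightarrow> 'v::ab_group_add \<Rightarrow> 'v" and q n act +
  fixes lam :: "nat list" and v :: "(nat \<times> nat \<Rightarrow> nat) \<Rightarrow> 'v"
  assumes partition: "is_partition lam n"
    and basis_inj: "inj_on v (SYT lam)"
    and basis_independent: "independent (v ` SYT lam)"
    and basis_span: "span (v ` SYT lam) = UNIV"
    and jucys_murphy_act: "S \<in> SYT lam \<Longrightarrow> 2 \<le> m \<Longrightarrow> m \<le> n \<Longrightarrow>
          act (jucys_murphy q n m) (v S) = scale (qint q (content m S)) (v S)"

end

theory Submission
  imports Defs
begin

text \<open>
  Write \<open>T\<^sub>w\<close> for the standard basis elements, \<open>T\<^sub>i\<close> for the generators and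
  \<open>L\<^sub>m = T\<^bsub>m-1\<^esub> \<cdots> T\<^sub>2 T\<^sub>1 T\<^sub>1 T\<^sub>2 \<cdots> T\<^bsub>m-1\<^esub>\<close>.  Since \<open>(i m)\<close> has length \<open>2(m - i) - 1\<close>, clearing the
  normalisations gives \<open>J\<^sub>m = \<Sum>\<^bsub>i<m\<^esub> q\<^bsup>i-m\<^esup> T\<^bsub>(i m)\<^esub>\<close> and \<open>K = q\<^bsup>-2(n-1)\<^esup> L\<^sub>n\<close>, so the formula for \<open>K\<close>
  amounts to \<open>L\<^sub>m = q\<^bsup>m-1\<^esup> + (q - 1) \<Sum>\<^bsub>i<m\<^esub> q\<^bsup>i-1\<^esup> T\<^bsub>(i m)\<^esub>\<close> at \<open>m = n\<close> (lemma \<open>scan_word_eq\<close>).  This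
  follows by induction on \<open>m\<close>: multiplying by \<open>T\<^sub>m\<close> on both sides turns \<open>T\<^bsub>(i m)\<^esub>\<close> into \<open>T\<^bsub>(i m+1)\<^esub>\<close>,
  because lengths add up, while \<open>T\<^sub>m q\<^bsup>m-1\<^esup> T\<^sub>m = q\<^bsup>m-1\<^esup> ((q - 1) T\<^sub>m + q)\<close> supplies the new summand,
  which belongs to \<open>T\<^bsub>(m m+1)\<^esub> = T\<^sub>m\<close>, and the new constant \<open>q\<^bsup>m\<^esup>\<close>.  The formula for \<open>P\<close> at \<open>k = 1\<close> is
  immediate from \<open>[n-1]\<^sub>q \<noteq> 0\<close>.  The eigenvalues are then the affine functions evaluated at
  \<open>[c]\<^sub>q\<close>: \<open>1 + q[c]\<^sub>q = [c+1]\<^sub>q\<close> and \<open>1 + (q - 1)[c]\<^sub>q = q\<^bsup>c\<^esup>\<close>.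

  The substance lies in making \<open>T\<^bsub>(i m)\<^esub>\<close> computable.  It is the product along an unspecified reduced
  word, so one needs Matsumoto's theorem (lemma \<open>matsumoto\<close>): two reduced words of the same
  permutation are connected by commutation and braid moves.  It is derived from the exchange
  property alone, and the same property certifies that the palindrome
  \<open>m-1, \<dots>, i+1, i, i+1, \<dots>, m-1\<close> is a reduced word of \<open>(i m)\<close>.

  All computations in the quotient algebra are transported to the free algebra, where
  the ring operations are those of a type class: equality in the Hecke algebra becomes equality of
  \<open>hecke_class\<close>, which every ring operation respects.
\<close>


section \<open>The exchange property and reduced words\<close>

lemma perm_of_word_Nil [simp]: "perm_of_word [] = id"
  by (simp add: perm_of_word_def)

lemma perm_of_word_Cons [simp]: "perm_of_word (i # is) = transpose i (Suc i) \<circ> perm_of_word is"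
  by (simp add: perm_of_word_def)

lemma perm_of_word_append [simp]: "perm_of_word (us @ vs) = perm_of_word us \<circ> perm_of_word vs"
  by (induction us) (simp_all add: comp_assoc)

lemma bij_perm_of_word: "bij (perm_of_word is)"
proof (induction "is")
  case (Cons i "is")
  then show ?case
    unfolding perm_of_word_Cons by (intro bij_comp bij_transpose)
qed (simp only: perm_of_word_Nil bij_id)

lemma inj_perm_of_word: "inj (perm_of_word is)"
  by (rule bij_is_inj) (rule bij_perm_of_word)

lemma perm_of_word_rev: "perm_of_word (rev is) = inv_into UNIV (perm_of_word is)"
proof (induction "is")
  case (Cons i "is")
  then show ?case
    unfolding perm_of_word_Cons
    by (subst o_inv_distrib) (simp_all only: bij_perm_of_word bij_transpose rev.simps
        perm_of_word_append perm_of_word_Cons perm_of_word_Nil inv_transpose_eq comp_id)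
qed simp

text \<open>
  The exchange property for arbitrary inversions \<open>x < y\<close>, not just adjacent ones: stripping the last
  letter \<open>j\<close> moves the inversion to \<open>s\<^sub>j x, s\<^sub>j y\<close>, in general no longer adjacent, and keeps
  its order unless \<open>(x, y) = (j, j + 1)\<close>, in which case \<open>j\<close> is the letter to delete.
\<close>

lemma exchange:
  assumes "x < y" and "perm_of_word is y < perm_of_word is x"
  shows "\<exists>js. set js \<subseteq> set is \<and> length is = Suc (length js) \<and>
           perm_of_word js = perm_of_word is \<circ> transpose x y"
  using assms
proof (induction "is" arbitrary: x y rule: rev_induct)
  case (snoc j "is")
  let ?s = "transpose j (Suc j)" and ?u = "perm_of_word is"
  show ?case
  proof (cases "x = j \<and> y = Suc j")
    case True
    then show ?thesis
      by (intro exI[of _ "is"]) (auto simp: comp_assoc)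
  next
    case False
    have "?s x < ?s y"
      using False snoc.prems(1) by (auto simp: transpose_def)
    moreover have "?u (?s y) < ?u (?s x)"
      using snoc.prems(2) by simp
    ultimately obtain js where js: "set js \<subseteq> set is" "length is = Suc (length js)"
        "perm_of_word js = ?u \<circ> transpose (?s x) (?s y)"
      using snoc.IH by blast
    have "transpose (?s x) (?s y) \<circ> ?s = ?s \<circ> transpose x y"
      by (auto simp: fun_eq_iff transpose_def)
    then show ?thesis
      using js by (intro exI[of _ "js @ [j]"]) (auto simp: comp_assoc)
  qed
qed simp

lemma reduced_word_perm: "reduced_word n w is \<Longrightarrow> perm_of_word is = w"
  by (simp add: reduced_word_def)

lemma reduced_word_length_eq:
  "reduced_word n w is \<Longrightarrow> reduced_word n w js \<Longrightarrow> length is = length js"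
  by (simp add: reduced_word_def order_antisym)

lemma reduced_wordI_length:
  assumes "reduced_word n w is" and "set js \<subseteq> {1..<n}" "perm_of_word js = w" "length js \<le> length is"
  shows "reduced_word n w js"
  using assms unfolding reduced_word_def by (meson order_trans)

text \<open>
  If the last letter of a reduced word were not a descent, the rest of the word would have one, and
  the exchange property would produce a word of \<open>w\<close> that is too short.  Conversely, at a
  descent, every word of \<open>w\<close> shortens to one of \<open>w s\<^sub>i\<close>.
\<close>

lemma reduced_word_snoc_iff:
  "reduced_word n w (is @ [i]) \<longleftrightarrow>
     reduced_word n (w \<circ> transpose i (Suc i)) is \<and> i \<in> {1..<n} \<and> w (Suc i) < w i"
  (is "?L \<longleftrightarrow> ?R")
proof
  assume L: ?L
  let ?u = "perm_of_word is"
  have w: "w = ?u \<circ> transpose i (Suc i)" and gens: "set is \<subseteq> {1..<n}" "i \<in> {1..<n}"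
    using L by (auto simp: reduced_word_def)
  have short: "length is < length js" if "set js \<subseteq> {1..<n}" "perm_of_word js = w" for js
    using L that by (auto simp: reduced_word_def)
  have u: "w \<circ> transpose i (Suc i) = ?u"
    by (simp add: w comp_assoc)
  have "?u i < ?u (Suc i)"
  proof (rule ccontr)
    assume "\<not> ?u i < ?u (Suc i)"
    moreover have "?u i \<noteq> ?u (Suc i)"
      using inj_perm_of_word[of "is"] by (simp add: inj_eq)
    ultimately obtain js where "set js \<subseteq> set is" "length is = Suc (length js)" "perm_of_word js = w"
      using exchange[of i "Suc i" "is"] w by auto
    with short[of js] gens show False
      by auto
  qed
  moreover have "length is \<le> length js" if "set js \<subseteq> {1..<n}" "perm_of_word js = ?u" for js
    using short[of "js @ [i]"] that gens w by auto
  ultimately show ?R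
    using gens u by (auto simp: reduced_word_def w)
next
  assume R: ?R
  have "length is < length js" if js: "set js \<subseteq> {1..<n}" "perm_of_word js = w" for js
  proof -
    obtain ks where "set ks \<subseteq> set js" "length js = Suc (length ks)"
        "perm_of_word ks = w \<circ> transpose i (Suc i)"
      using exchange[of i "Suc i" js] R js by auto
    moreover from this have "set ks \<subseteq> {1..<n}"
      using js by blast
    ultimately show ?thesis
      using R unfolding reduced_word_def by (metis le_imp_less_Suc)
  qed
  then show ?L
    using R by (auto simp: reduced_word_def comp_assoc less_eq_Suc_le)
qed

lemma reduced_word_rev:
  assumes "reduced_word n w is"
  shows "reduced_word n (inv_into UNIV w) (rev is)"
proof -
  have "length is \<le> length js"
    if "set js \<subseteq> {1..<n}" "perm_of_word js = inv_into UNIV w" for js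
  proof -
    have "perm_of_word (rev js) = w"
      using assms that bij_perm_of_word[of "is"]
      by (simp add: perm_of_word_rev inv_inv_eq reduced_word_def)
    then show ?thesis
      using assms that unfolding reduced_word_def by (metis length_rev set_rev)
  qed
  then show ?thesis
    using assms by (auto simp: reduced_word_def perm_of_word_rev)
qed


section \<open>Matsumoto's theorem for the symmetric group\<close>

inductive braid_equiv :: "nat \<Rightarrow> nat list \<Rightarrow> nat list \<Rightarrow> bool" for n where
  commute: "\<lbrakk>i \<in> {1..<n}; j \<in> {1..<n}; \<bar>int i - int j\<bar> \<ge> 2\<rbrakk> \<Longrightarrow>
     braid_equiv n (us @ [i, j] @ vs) (us @ [j, i] @ vs)"
| braid: "\<lbrakk>i \<in> {1..<n}; i + 1 \<in> {1..<n}\<rbrakk> \<Longrightarrow>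
     braid_equiv n (us @ [i, i + 1, i] @ vs) (us @ [i + 1, i, i + 1] @ vs)"
| refl: "braid_equiv n us us"
| sym: "braid_equiv n us vs \<Longrightarrow> braid_equiv n vs us"
| trans: "braid_equiv n us vs \<Longrightarrow> braid_equiv n vs ws \<Longrightarrow> braid_equiv n us ws"

lemma braid_equiv_append: "braid_equiv n us vs \<Longrightarrow> braid_equiv n (us @ ws) (vs @ ws)"
proof (induction rule: braid_equiv.induct)
  case (commute i j us vs)
  then show ?case
    using braid_equiv.commute[of i n j us "vs @ ws"] by simp
next
  case (braid i us vs)
  then show ?case
    using braid_equiv.braid[of i n us "vs @ ws"] by simp
qed (auto intro: braid_equiv.intros)

text \<open>
  Induction on the length.  If the last letters \<open>i \<noteq> j\<close> of the two words differ, both are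
  descents of \<open>w\<close>, and so the exchange property strips from \<open>w\<close> the longest element of the parabolic subgroup that
  \<open>s\<^sub>i\<close> and \<open>s\<^sub>j\<close> generate.  This gives a word \<open>xs\<close> such that appending either reduced word of that
  longest element yields a reduced word of \<open>w\<close>.  These two words differ by one move, and each shares its
  last letter with one of the given words, so the induction hypothesis connects them.
\<close>

lemma matsumoto:
  "reduced_word n w is \<Longrightarrow> reduced_word n w js \<Longrightarrow> braid_equiv n is js"
proof (induction "length is" arbitrary: w "is" js rule: less_induct)
  case less
  have len: "length js = length is"
    using reduced_word_length_eq less.prems by metis
  \<comment> \<open>The case \<open>j = i + 1\<close>, stated so that it serves both orders of the two words.\<close>
  have adjacent: "braid_equiv n is js"
    if "reduced_word n w (as @ [i])" "reduced_word n w (bs @ [Suc i])"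
      "is = as @ [i] \<and> js = bs @ [Suc i] \<or> js = as @ [i] \<and> is = bs @ [Suc i]" for as bs i
  proof -
    let ?s = "transpose i (Suc i)" and ?t = "transpose (Suc i) (Suc (Suc i))"
    have as: "reduced_word n (w \<circ> ?s) as" "i \<in> {1..<n}" "w (Suc i) < w i"
      and bs: "reduced_word n (w \<circ> ?t) bs" "Suc i \<in> {1..<n}" "w (Suc (Suc i)) < w (Suc i)"
      using that(1,2) by (simp_all add: reduced_word_snoc_iff)
    have la: "length as = length bs" "length as < length is"
      using that len by auto
    have pas: "perm_of_word as = w \<circ> ?s"
      using as(1) by (rule reduced_word_perm)
    \<comment> \<open>As \<open>w i > w (i+1) > w (i+2)\<close>, two further exchanges strip \<open>s\<^sub>i s\<^sub>i\<^sub>+\<^sub>1 s\<^sub>i\<close> from \<open>w\<close> altogether.\<close>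
    obtain ys where ys: "set ys \<subseteq> set as" "length as = Suc (length ys)"
        "perm_of_word ys = w \<circ> ?s \<circ> ?t"
      using exchange[of "Suc i" "Suc (Suc i)" as] as bs by (auto simp: pas)
    obtain xs where xs: "set xs \<subseteq> set ys" "length ys = Suc (length xs)"
        "perm_of_word xs = w \<circ> ?s \<circ> ?t \<circ> ?s"
      using exchange[of i "Suc i" ys] bs by (auto simp: ys)
    have sets: "set xs \<subseteq> {1..<n}"
      using as(1) ys(1) xs(1) by (auto simp: reduced_word_def)
    have braid: "?s \<circ> ?t \<circ> ?s = ?t \<circ> ?s \<circ> ?t"
      by (auto simp: fun_eq_iff transpose_def)
    have cancel: "f \<circ> ?s \<circ> ?s = f" "f \<circ> ?t \<circ> ?t = f" for f :: "nat \<Rightarrow> nat"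
      by (simp_all add: comp_assoc)
    have "reduced_word n (w \<circ> ?s) (xs @ [i, Suc i])"
      using as(1) by (rule reduced_wordI_length)
        (use sets as(2) bs(2) xs ys in \<open>simp_all add: comp_assoc[symmetric] cancel\<close>)
    moreover have "reduced_word n (w \<circ> ?t) (xs @ [Suc i, i])"
    proof (rule reduced_wordI_length[OF bs(1)])
      have "perm_of_word (xs @ [Suc i, i]) = w \<circ> (?s \<circ> ?t \<circ> ?s) \<circ> ?t \<circ> ?s"
        by (simp add: xs comp_assoc)
      also have "\<dots> = w \<circ> ?t"
        unfolding braid by (simp add: comp_assoc[symmetric] cancel)
      finally show "perm_of_word (xs @ [Suc i, i]) = w \<circ> ?t" .
    qed (use sets as(2) bs(2) xs ys la in simp_all)
    ultimately have "braid_equiv n as (xs @ [i, Suc i])" "braid_equiv n bs (xs @ [Suc i, i])"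
      using less.hyps as(1) bs(1) la by metis+
    then have "braid_equiv n (as @ [i]) (xs @ [i, Suc i, i])"
        "braid_equiv n (bs @ [Suc i]) (xs @ [Suc i, i, Suc i])"
      using braid_equiv_append by fastforce+
    moreover have "braid_equiv n (xs @ [i, Suc i, i]) (xs @ [Suc i, i, Suc i])"
      using braid_equiv.braid[of i n xs "[]"] as(2) bs(2) by simp
    ultimately have "braid_equiv n (as @ [i]) (bs @ [Suc i])"
      by (meson braid_equiv.sym braid_equiv.trans)
    then show ?thesis
      using that(3) by (auto intro: braid_equiv.sym)
  qed
  show ?case
  proof (cases "is" rule: rev_cases)
    case Nil
    then show ?thesis
      using len by (simp add: braid_equiv.refl)
  next
    case is_snoc: (snoc as i)
    then obtain bs j where js_snoc: "js = bs @ [j]"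
      using len by (cases js rule: rev_cases) auto
    let ?s = "transpose i (Suc i)" and ?t = "transpose j (Suc j)"
    have as: "reduced_word n (w \<circ> ?s) as" "i \<in> {1..<n}" "w (Suc i) < w i"
      and bs: "reduced_word n (w \<circ> ?t) bs" "j \<in> {1..<n}" "w (Suc j) < w j"
      using less.prems by (simp_all add: reduced_word_snoc_iff is_snoc js_snoc)
    have la: "length bs = length as" "length as < length is"
      using len by (simp_all add: is_snoc js_snoc)
    consider "i = j" | "j = Suc i" | "i = Suc j" | "\<bar>int i - int j\<bar> \<ge> 2"
      by linarith
    then show ?thesis
    proof cases
      case 1
      then have "braid_equiv n as bs"
        using less.hyps as(1) bs(1) la by metis
      then show ?thesis
        using 1 by (simp add: is_snoc js_snoc braid_equiv_append)
    next
      case 2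
      then show ?thesis
        using adjacent[of as i bs] less.prems is_snoc js_snoc by simp
    next
      case 3
      then show ?thesis
        using adjacent[of bs j as] less.prems is_snoc js_snoc by simp
    next
      case 4
      have pas: "perm_of_word as = w \<circ> ?s"
        using as(1) by (rule reduced_word_perm)
      have "?s j = j" "?s (Suc j) = Suc j"
        using 4 by (auto simp: transpose_def)
      then obtain xs where xs: "set xs \<subseteq> set as" "length as = Suc (length xs)"
          "perm_of_word xs = w \<circ> ?s \<circ> ?t"
        using exchange[of j "Suc j" as] bs by (auto simp: pas)
      have sets: "set xs \<subseteq> {1..<n}"
        using as(1) xs(1) by (auto simp: reduced_word_def)
      have comm: "?s \<circ> ?t = ?t \<circ> ?s"
        using 4 by (auto simp: fun_eq_iff transpose_def)
      have "reduced_word n (w \<circ> ?s) (xs @ [j])"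
        using as(1) by (rule reduced_wordI_length) (use sets bs(2) xs in \<open>simp_all add: comp_assoc\<close>)
      moreover have "perm_of_word (xs @ [i]) = w \<circ> ?t"
        using xs(3) comm by (simp add: comp_assoc)
      then have "reduced_word n (w \<circ> ?t) (xs @ [i])"
        by (intro reduced_wordI_length[OF bs(1)]) (use sets as(2) xs(2) la in simp_all)
      ultimately have "braid_equiv n as (xs @ [j])" "braid_equiv n bs (xs @ [i])"
        using less.hyps as(1) bs(1) la by metis+
      then have "braid_equiv n (as @ [i]) (xs @ [j, i])" "braid_equiv n (bs @ [j]) (xs @ [i, j])"
        using braid_equiv_append by fastforce+
      moreover have "braid_equiv n (xs @ [i, j]) (xs @ [j, i])"
        using braid_equiv.commute[of i n j xs "[]"] as(2) bs(2) 4 by simp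
      ultimately show ?thesis
        unfolding is_snoc js_snoc by (meson braid_equiv.sym braid_equiv.trans)
    qed
  qed
qed


section \<open>Transpositions\<close>

definition transposition_word :: "nat \<Rightarrow> nat \<Rightarrow> nat list" where
  "transposition_word i m = rev [Suc i..<m] @ [i..<m]"

lemma transposition_word_Suc_self: "transposition_word i (Suc i) = [i]"
  by (simp add: transposition_word_def)

lemma transposition_word_Suc:
  "i < m \<Longrightarrow> transposition_word i (Suc m) = m # transposition_word i m @ [m]"
  by (simp add: transposition_word_def)

lemma rev_transposition_word: "i < m \<Longrightarrow> rev (transposition_word i m) = transposition_word i m"
  by (simp add: transposition_word_def upt_conv_Cons)

text \<open>
  Passing from \<open>m\<close> to \<open>m + 1\<close> adds the letter \<open>m\<close> on both sides.  Descents control only the last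
  letter, so the left letter is added by reversing the word, which is harmless as the word is a
  palindrome and the transposition an involution.
\<close>

lemma reduced_transposition_word:
  assumes "1 \<le> i" "Suc i \<le> m" "m \<le> n"
  shows "reduced_word n (transpose i m) (transposition_word i m)"
  using assms(2,3)
proof (induction m rule: dec_induct)
  case base
  have "reduced_word n id []"
    by (simp add: reduced_word_def)
  then have "reduced_word n (transpose i (Suc i)) ([] @ [i])"
    unfolding reduced_word_snoc_iff using assms(1) base by simp
  then show ?case
    by (simp add: transposition_word_Suc_self)
next
  case (step m)
  let ?t = "transpose i m" and ?s = "transpose m (Suc m)" and ?ws = "transposition_word i m"
  have t: "reduced_word n ?t ?ws"
    using step by simp
  have "reduced_word n (?t \<circ> ?s) (?ws @ [m])"
    unfolding reduced_word_snoc_iff using t step assms(1) by (simp add: comp_assoc)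
  then have "reduced_word n (inv_into UNIV (?t \<circ> ?s)) (rev (?ws @ [m]))"
    by (rule reduced_word_rev)
  moreover have "inv_into UNIV (?t \<circ> ?s) = ?s \<circ> ?t"
    by (simp add: o_inv_distrib)
  moreover have "rev (?ws @ [m]) = m # ?ws"
    using step by (simp add: rev_transposition_word)
  ultimately have "reduced_word n (?s \<circ> ?t) (m # ?ws)"
    by simp
  moreover have "transpose i (Suc m) = ?s \<circ> ?t \<circ> ?s"
    using step by (auto simp: fun_eq_iff transpose_def)
  ultimately have "reduced_word n (transpose i (Suc m)) ((m # ?ws) @ [m])"
    unfolding reduced_word_snoc_iff using step assms(1) by (simp add: comp_assoc)
  then show ?case
    using step by (simp add: transposition_word_Suc)
qed

lemma inversions_transpose:
  assumes "1 \<le> i" "i < m" "m \<le> n"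
  shows "inversions n (transpose i m) = 2 * (m - i) - 1"
proof -
  have "{(a, b). 1 \<le> a \<and> a < b \<and> b \<le> n \<and> transpose i m b < transpose i m a} =
      Pair i ` {i<..m} \<union> (\<lambda>a. (a, m)) ` {i<..<m}" (is "_ = ?A \<union> ?B")
    using assms by (auto simp: transpose_def split: if_splits)
  moreover have "card (?A \<union> ?B) = card ?A + card ?B"
    by (rule card_Un_disjoint) auto
  moreover have "card ?A = m - i" "card ?B = m - i - 1"
    by (simp_all add: card_image inj_on_def)
  ultimately show ?thesis
    using assms unfolding inversions_def by simp
qed


section \<open>Computing in the Hecke algebra by representatives\<close>

lemma fconst_mult: "fconst (a * b) = fconst a * fconst b"
  by (simp add: fconst_def mult_single)

lemma fconst_1 [simp]: "fconst 1 = 1"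
  by (simp add: fconst_def)

lemma fconst_commute: "f * fconst c = fconst c * f"
proof (induction f rule: Poly_Mapping.update_induct)
  case (update f a b)
  then have "Poly_Mapping.update a b f = Poly_Mapping.single a b + f"
    by (intro poly_mapping_eqI)
      (auto simp: lookup_update lookup_add lookup_single in_keys_iff when_def)
  moreover have "Poly_Mapping.single a b * fconst c = fconst c * Poly_Mapping.single a b"
    by (simp add: fconst_def mult_single mult.commute)
  ultimately show ?case
    using update by (simp add: distrib_left distrib_right)
qed simp

abbreviation free_carrier :: "nat \<Rightarrow> (gen_word \<Rightarrow>\<^sub>0 complex) set" where
  "free_carrier n \<equiv> carrier (free_alg n)"

lemma free_alg_simps [simp]:
  "f \<otimes>\<^bsub>free_alg n\<^esub> g = f * g" "\<one>\<^bsub>free_alg n\<^esub> = 1" "\<zero>\<^bsub>free_alg n\<^esub> = 0"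
  "f \<oplus>\<^bsub>free_alg n\<^esub> g = f + g" "c \<odot>\<^bsub>free_alg n\<^esub> f = fconst c * f"
  by (simp_all add: free_alg_def fconst_def)

lemma free_carrier_iff:
  "f \<in> free_carrier n \<longleftrightarrow> (\<forall>w \<in> Poly_Mapping.keys f. set (letters w) \<subseteq> {1..<n})"
  by (simp add: free_alg_def)

lemma fconst_in_free_carrier [simp]: "fconst c \<in> free_carrier n"
  by (auto simp: free_carrier_iff fconst_def zero_gen_word_def)

lemma one_in_free_carrier [simp]: "1 \<in> free_carrier n"
  using fconst_in_free_carrier[of 1] by simp

lemma fgen_in_free_carrier [simp]: "fgen i \<in> free_carrier n \<longleftrightarrow> i \<in> {1..<n}"
  by (auto simp: free_carrier_iff fgen_def)

lemma add_in_free_carrier [simp]: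
  "f \<in> free_carrier n \<Longrightarrow> g \<in> free_carrier n \<Longrightarrow> f + g \<in> free_carrier n"
  using Poly_Mapping.keys_add[of f g] unfolding free_carrier_iff by blast

lemma uminus_in_free_carrier [simp]: "f \<in> free_carrier n \<Longrightarrow> - f \<in> free_carrier n"
  by (simp add: free_carrier_iff)

lemma diff_in_free_carrier [simp]:
  "f \<in> free_carrier n \<Longrightarrow> g \<in> free_carrier n \<Longrightarrow> f - g \<in> free_carrier n"
  using add_in_free_carrier[of f n "- g"] by simp

lemma mult_in_free_carrier [simp]:
  assumes "f \<in> free_carrier n" "g \<in> free_carrier n"
  shows "f * g \<in> free_carrier n"
  unfolding free_carrier_iff
proof
  fix w assume "w \<in> Poly_Mapping.keys (f * g)"
  then obtain u v where "w = u + v" "u \<in> Poly_Mapping.keys f" "v \<in> Poly_Mapping.keys g"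
    using Poly_Mapping.keys_mult[of f g] by blast
  then show "set (letters w) \<subseteq> {1..<n}"
    using assms unfolding free_carrier_iff by (simp add: plus_gen_word_def)
qed

lemma sum_in_free_carrier [simp]:
  "(\<And>i. i \<in> A \<Longrightarrow> f i \<in> free_carrier n) \<Longrightarrow> (\<Sum>i\<in>A. f i) \<in> free_carrier n"
proof (induction A rule: infinite_finite_induct)
  case (insert i A)
  then show ?case
    by simp
qed (simp_all add: free_carrier_iff)

lemma ring_free_alg: "ring (free_alg n)"
proof (rule ringI)
  show "abelian_group (free_alg n)"
  proof (rule abelian_groupI)
    show "\<exists>g\<in>free_carrier n. g \<oplus>\<^bsub>free_alg n\<^esub> f = \<zero>\<^bsub>free_alg n\<^esub>" if "f \<in> free_carrier n" for f
      using that by (intro bexI[of _ "- f"]) simp_all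
  qed (auto simp: add_ac free_carrier_iff[of 0])
  show "Group.monoid (free_alg n)"
    by (rule monoidI) (simp_all add: mult.assoc)
qed (simp_all add: distrib_left distrib_right)

lemma free_alg_minus:
  assumes "f \<in> free_carrier n" "g \<in> free_carrier n"
  shows "f \<ominus>\<^bsub>free_alg n\<^esub> g = f - g"
proof -
  interpret ring "free_alg n" by (rule ring_free_alg)
  have "\<ominus>\<^bsub>free_alg n\<^esub> g = - g"
    using assms by (intro minus_equality) simp_all
  then show ?thesis
    by (simp add: a_minus_def)
qed

lemma hecke_rels_subset: "hecke_rels q n \<subseteq> free_carrier n"
  by (auto simp: hecke_rels_def)

lemma ideal_hecke_ideal: "ideal (hecke_ideal q n) (free_alg n)"
  unfolding hecke_ideal_def by (intro ring.genideal_ideal ring_free_alg hecke_rels_subset)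

definition hecke_class ::
  "complex \<Rightarrow> nat \<Rightarrow> (gen_word \<Rightarrow>\<^sub>0 complex) \<Rightarrow> (gen_word \<Rightarrow>\<^sub>0 complex) set" where
  "hecke_class q n f = hecke_ideal q n +>\<^bsub>free_alg n\<^esub> f"

lemma hecke_class_in_carrier [simp]:
  "f \<in> free_carrier n \<Longrightarrow> hecke_class q n f \<in> carrier (hecke_alg q n)"
  by (auto simp: hecke_alg_def ring.defs module.defs FactRing_def hecke_class_def A_RCOSETS_def')

lemma one_hecke_alg: "\<one>\<^bsub>hecke_alg q n\<^esub> = hecke_class q n 1"
  by (simp add: hecke_alg_def ring.defs module.defs FactRing_def hecke_class_def)

lemma zero_hecke_alg: "\<zero>\<^bsub>hecke_alg q n\<^esub> = hecke_class q n 0"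
  using ring.a_rcos_zero[OF ring_free_alg ideal_hecke_ideal
      additive_subgroup.zero_closed[OF ideal.axioms(1)[OF ideal_hecke_ideal]], of n q]
  by (simp add: hecke_alg_def ring.defs module.defs FactRing_def hecke_class_def)

lemma hecke_class_mult:
  "f \<in> free_carrier n \<Longrightarrow> g \<in> free_carrier n \<Longrightarrow>
     hecke_class q n f \<otimes>\<^bsub>hecke_alg q n\<^esub> hecke_class q n g = hecke_class q n (f * g)"
  using ideal.rcoset_mult_add[OF ideal_hecke_ideal]
  by (simp add: hecke_alg_def ring.defs module.defs FactRing_def hecke_class_def)

lemma hecke_class_add:
  "f \<in> free_carrier n \<Longrightarrow> g \<in> free_carrier n \<Longrightarrow>
     hecke_class q n f \<oplus>\<^bsub>hecke_alg q n\<^esub> hecke_class q n g = hecke_class q n (f + g)"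
  using ideal.a_rcos_sum[OF ideal_hecke_ideal]
  by (simp add: hecke_alg_def ring.defs module.defs FactRing_def hecke_class_def)

lemma hecke_class_eq_iff:
  "f \<in> free_carrier n \<Longrightarrow> g \<in> free_carrier n \<Longrightarrow>
     hecke_class q n f = hecke_class q n g \<longleftrightarrow> f - g \<in> hecke_ideal q n"
  using ring.quotient_eq_iff_same_a_r_cos[OF ring_free_alg ideal_hecke_ideal]
  by (simp add: hecke_class_def free_alg_minus)

text \<open>
  Scalar multiplication of a coset is a union over all its members; it collapses to
  a single coset because the ideal is stable under left multiplication by constants.
\<close>

lemma hecke_class_smult:
  assumes "f \<in> free_carrier n"
  shows "c \<odot>\<^bsub>hecke_alg q n\<^esub> hecke_class q n f = hecke_class q n (fconst c * f)"
proof -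
  interpret I: ideal "hecke_ideal q n" "free_alg n" by (rule ideal_hecke_ideal)
  have "hecke_class q n (fconst c * g) = hecke_class q n (fconst c * f)"
    if g: "g \<in> hecke_class q n f" for g
  proof -
    obtain h where h: "h \<in> hecke_ideal q n" "g = h + f"
      using g by (auto simp: hecke_class_def a_r_coset_def')
    then have hc: "h \<in> free_carrier n" and "fconst c * h \<in> hecke_ideal q n"
      using I.Icarr I.I_l_closed[of h "fconst c"] by simp_all
    then show ?thesis
      using assms h by (simp add: hecke_class_eq_iff distrib_left)
  qed
  moreover have "f \<in> hecke_class q n f"
    using I.a_rcos_self[OF assms] by (simp add: hecke_class_def)
  ultimately have "(\<Union>g\<in>hecke_class q n f. hecke_class q n (fconst c * g)) =
      hecke_class q n (fconst c * f)"
    by blast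
  then show ?thesis
    by (simp add: hecke_alg_def ring.defs module.defs FactRing_def hecke_class_def)
qed

lemma abelian_monoid_hecke_alg: "abelian_monoid (hecke_alg q n)"
proof -
  interpret Quot: ring "free_alg n Quot hecke_ideal q n"
    by (rule ideal.quotient_is_ring[OF ideal_hecke_ideal])
  show ?thesis
    by (rule abelian_monoidI) (simp_all add: hecke_alg_def ring.defs module.defs Quot.a_ac)
qed

lemma hecke_class_add_cong:
  assumes "hecke_class q n f = hecke_class q n f'" "hecke_class q n g = hecke_class q n g'"
    and "f \<in> free_carrier n" "f' \<in> free_carrier n" "g \<in> free_carrier n" "g' \<in> free_carrier n"
  shows "hecke_class q n (f + g) = hecke_class q n (f' + g')"
  using assms by (metis hecke_class_add)

lemma hecke_class_sum:
  assumes "finite A" "\<And>i. i \<in> A \<Longrightarrow> f i \<in> free_carrier n"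
  shows "(\<Oplus>\<^bsub>hecke_alg q n\<^esub>i\<in>A. hecke_class q n (f i)) = hecke_class q n (\<Sum>i\<in>A. f i)"
proof -
  interpret abelian_monoid "hecke_alg q n"
    by (rule abelian_monoid_hecke_alg)
  show ?thesis
    using assms
  proof (induction A rule: finite_induct)
    case empty
    show ?case
      by (simp add: zero_hecke_alg)
  next
    case (insert i A)
    then show ?case
      by (subst finsum_insert) (auto simp: hecke_class_add)
  qed
qed

lemma hecke_class_mult_cong:
  assumes "hecke_class q n f = hecke_class q n f'" "hecke_class q n g = hecke_class q n g'"
    and "f \<in> free_carrier n" "f' \<in> free_carrier n" "g \<in> free_carrier n" "g' \<in> free_carrier n"
  shows "hecke_class q n (f * g) = hecke_class q n (f' * g')"
  using assms by (metis hecke_class_mult)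

lemma hecke_class_relation:
  assumes "f - g \<in> hecke_rels q n" "f \<in> free_carrier n" "g \<in> free_carrier n"
  shows "hecke_class q n f = hecke_class q n g"
  using assms ring.genideal_self[OF ring_free_alg hecke_rels_subset]
  by (auto simp: hecke_class_eq_iff hecke_ideal_def)

lemma hecke_class_quadratic:
  "i \<in> {1..<n} \<Longrightarrow>
     hecke_class q n (fgen i * fgen i) = hecke_class q n (fconst (q - 1) * fgen i + fconst q)"
  by (intro hecke_class_relation) (auto simp: hecke_rels_def)

definition word_product :: "nat list \<Rightarrow> gen_word \<Rightarrow>\<^sub>0 complex" where
  "word_product is = prod_list (map fgen is)"

lemma word_product_simps [simp]:
  "word_product [] = 1" "word_product (i # is) = fgen i * word_product is"
  "word_product (is @ js) = word_product is * word_product js"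
  by (simp_all add: word_product_def)

lemma word_product_in_free_carrier [simp]:
  "set is \<subseteq> {1..<n} \<Longrightarrow> word_product is \<in> free_carrier n"
  by (induction "is") simp_all

lemma list_mult_hecke_class:
  "(\<And>x. x \<in> set xs \<Longrightarrow> f x \<in> free_carrier n) \<Longrightarrow>
     list_mult (hecke_alg q n) (map (\<lambda>x. hecke_class q n (f x)) xs) =
       hecke_class q n (prod_list (map f xs)) \<and>
     prod_list (map f xs) \<in> free_carrier n"
  by (induction xs) (simp_all add: list_mult_def one_hecke_alg hecke_class_mult)

text \<open>
  The defining relations of the Hecke algebra contain the commutation and braid moves.  That
  equivalent words use the same generators keeps both sides inside the free algebra.
\<close>

lemma braid_equiv_hecke_class:
  assumes "braid_equiv n is js"
  shows "set is \<subseteq> {1..<n} \<longleftrightarrow> set js \<subseteq> {1..<n}" and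
    "set is \<subseteq> {1..<n} \<Longrightarrow> hecke_class q n (word_product is) = hecke_class q n (word_product js)"
proof -
  have context_cong: "hecke_class q n (word_product (us @ as @ vs)) =
      hecke_class q n (word_product (us @ bs @ vs))"
    if "hecke_class q n (word_product as) = hecke_class q n (word_product bs)"
      "set (us @ as @ vs) \<subseteq> {1..<n}" "set bs \<subseteq> {1..<n}" for us as bs vs
    using that unfolding word_product_simps(3)
    by (intro hecke_class_mult_cong) simp_all
  have "(set is \<subseteq> {1..<n} \<longleftrightarrow> set js \<subseteq> {1..<n}) \<and>
    (set is \<subseteq> {1..<n} \<longrightarrow> hecke_class q n (word_product is) = hecke_class q n (word_product js))"
    using assms
  proof (induction rule: braid_equiv.induct)
    case (commute i j us vs)
    have "hecke_class q n (word_product [i, j]) = hecke_class q n (word_product [j, i])"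
      by (intro hecke_class_relation) (use commute in \<open>auto simp: hecke_rels_def\<close>)
    then show ?case
      using commute context_cong[of "[i, j]" "[j, i]" us vs] by simp
  next
    case (braid i us vs)
    have "hecke_class q n (word_product [i, i + 1, i]) =
        hecke_class q n (word_product [i + 1, i, i + 1])"
      by (intro hecke_class_relation) (use braid in \<open>auto simp: hecke_rels_def mult.assoc\<close>)
    then show ?case
      using braid context_cong[of "[i, i + 1, i]" "[i + 1, i, i + 1]" us vs] by simp
  qed auto
  then show "set is \<subseteq> {1..<n} \<longleftrightarrow> set js \<subseteq> {1..<n}" and
    "set is \<subseteq> {1..<n} \<Longrightarrow> hecke_class q n (word_product is) = hecke_class q n (word_product js)"
    by blast+
qed

text \<open>Matsumoto's theorem makes the choice of a reduced word in the definition of \<open>T\<^sub>w\<close> irrelevant.\<close>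

lemma hecke_T_eq:
  assumes "reduced_word n w is"
  shows "hecke_T q n w = hecke_class q n (word_product is)"
proof -
  let ?js = "SOME js. reduced_word n w js"
  have js: "reduced_word n w ?js"
    using assms by (rule someI)
  then have gens: "set ?js \<subseteq> {1..<n}"
    by (simp add: reduced_word_def)
  have "hecke_T q n w = list_mult (hecke_alg q n) (map (\<lambda>i. hecke_class q n (fgen i)) ?js)"
    by (simp add: hecke_T_def hecke_gen_def[abs_def] hecke_class_def)
  also have "\<dots> = hecke_class q n (word_product ?js)"
    unfolding word_product_def
    by (rule conjunct1, rule list_mult_hecke_class) (use gens in \<open>simp add: subset_iff\<close>)
  also have "\<dots> = hecke_class q n (word_product is)"
    using braid_equiv_hecke_class(2)[OF matsumoto[OF js assms] gens] .
  finally show ?thesis .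
qed

lemma set_transposition_word: "1 \<le> i \<Longrightarrow> m \<le> n \<Longrightarrow> set (transposition_word i m) \<subseteq> {1..<n}"
  by (auto simp: transposition_word_def)

lemma hecke_Ttilde_transpose:
  assumes "1 \<le> i" "i < m" "m \<le> n"
  shows "hecke_Ttilde q n (transpose i m) =
    hecke_class q n (fconst (q powi (1 - 2 * int (m - i))) * word_product (transposition_word i m))"
proof -
  have "- int (2 * (m - i) - 1) = 1 - 2 * int (m - i)"
    using assms by simp
  then show ?thesis
    using assms set_transposition_word[of i m n]
    by (simp add: hecke_Ttilde_def inversions_transpose hecke_T_eq[OF reduced_transposition_word]
        hecke_class_smult)
qed


section \<open>Jucys--Murphy elements and the two shuffles\<close>

text \<open>
  The exponent \<open>i - m\<close> combines the factor \<open>q\<^bsup>m-1-i\<^esup>\<close> of the Jucys--Murphy element with the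
  normalisation \<open>q\<^bsup>1-2(m-i)\<^esup>\<close> of the transposition.
\<close>

definition jucys_murphy_lift :: "complex \<Rightarrow> nat \<Rightarrow> gen_word \<Rightarrow>\<^sub>0 complex" where
  "jucys_murphy_lift q m =
     (\<Sum>i\<in>{1..<m}. fconst (q powi (int i - int m)) * word_product (transposition_word i m))"

lemma jucys_murphy_lift_in_free_carrier [simp]:
  "m \<le> n \<Longrightarrow> jucys_murphy_lift q m \<in> free_carrier n"
  unfolding jucys_murphy_lift_def using set_transposition_word[of _ m n]
  by (intro sum_in_free_carrier mult_in_free_carrier) simp_all

lemma jucys_murphy_eq:
  assumes "q \<noteq> 0" "m \<le> n"
  shows "jucys_murphy q n m = hecke_class q n (jucys_murphy_lift q m)"
proof -
  have "q ^ (m - 1 - i) \<odot>\<^bsub>hecke_alg q n\<^esub> hecke_Ttilde q n (transpose i m) =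
      hecke_class q n (fconst (q powi (int i - int m)) * word_product (transposition_word i m))"
    if i: "i \<in> {1..<m}" for i
  proof -
    have "q ^ (m - 1 - i) * q powi (1 - 2 * int (m - i)) =
        q powi (int (m - 1 - i) + (1 - 2 * int (m - i)))"
      using assms by (simp only: power_int_add power_int_of_nat simp_thms)
    also have "int (m - 1 - i) + (1 - 2 * int (m - i)) = int i - int m"
      using i by (simp add: of_nat_diff)
    finally show ?thesis
      using i assms set_transposition_word[of i m n]
      by (simp add: hecke_Ttilde_transpose hecke_class_smult mult.assoc[symmetric]
          fconst_mult[symmetric])
  qed
  then have "jucys_murphy q n m = (\<Oplus>\<^bsub>hecke_alg q n\<^esub>i\<in>{1..<m}.
      hecke_class q n (fconst (q powi (int i - int m)) * word_product (transposition_word i m)))"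
    unfolding jucys_murphy_def using assms set_transposition_word[of _ m n]
    by (intro abelian_monoid.finsum_cong'[OF abelian_monoid_hecke_alg]) auto
  also have "\<dots> = hecke_class q n (jucys_murphy_lift q m)"
    unfolding jucys_murphy_lift_def
    using assms set_transposition_word[of _ m n] by (intro hecke_class_sum) simp_all
  finally show ?thesis .
qed

text \<open>
  Multiplying by \<open>T\<^sub>m\<close> on both sides sends each \<open>T\<^bsub>(i m)\<^esub>\<close> to \<open>T\<^bsub>(i m+1)\<^esub>\<close>, so only the constant term
  \<open>q\<^bsup>m-1\<^esup>\<close> meets the quadratic relation, and it produces the summand of \<open>T\<^bsub>(m m+1)\<^esub>\<close>.
\<close>

lemma scan_word_eq:
  assumes "1 \<le> m" "m \<le> n"
  shows "hecke_class q n (word_product (rev [1..<m] @ [1..<m])) =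
    hecke_class q n (fconst (q ^ (m - 1)) +
      (\<Sum>i\<in>{1..<m}. fconst ((q - 1) * q ^ (i - 1)) * word_product (transposition_word i m)))"
  using assms
proof (induction m rule: dec_induct)
  case base
  then show ?case
    by simp
next
  case (step m)
  let ?T = "fgen m" and ?W = "\<lambda>m i. word_product (transposition_word i m)"
  let ?c = "\<lambda>i. fconst ((q - 1) * q ^ (i - 1))"
  let ?S = "\<lambda>m. \<Sum>i\<in>{1..<m}. ?c i * ?W m i"
  let ?S' = "\<Sum>i\<in>{1..<m}. ?c i * ?W (Suc m) i"
  have T: "?T \<in> free_carrier n"
    using step by simp
  have S: "?S m \<in> free_carrier n" "?S' \<in> free_carrier n"
    using step set_transposition_word[of _ _ n]
    by (intro sum_in_free_carrier mult_in_free_carrier; simp)+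
  have "hecke_class q n (word_product (rev [1..<Suc m] @ [1..<Suc m])) =
      hecke_class q n (?T * word_product (rev [1..<m] @ [1..<m]) * ?T)"
    using step by (simp add: mult.assoc)
  also have "\<dots> = hecke_class q n (?T * (fconst (q ^ (m - 1)) + ?S m) * ?T)"
    using step T S by (intro hecke_class_mult_cong step.IH refl) auto
  also have "?T * (fconst (q ^ (m - 1)) + ?S m) * ?T = fconst (q ^ (m - 1)) * (?T * ?T) + ?S'"
  proof -
    have "?T * (?c i * ?W m i) * ?T = ?c i * ?W (Suc m) i" if "i \<in> {1..<m}" for i
      using that by (simp add: transposition_word_Suc fconst_commute mult.assoc[symmetric])
    then have "?T * ?S m * ?T = ?S'"
      by (simp add: sum_distrib_left sum_distrib_right)
    then show ?thesis
      by (simp add: distrib_left distrib_right fconst_commute mult.assoc[symmetric])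
  qed
  also have "hecke_class q n (fconst (q ^ (m - 1)) * (?T * ?T) + ?S') =
      hecke_class q n (fconst (q ^ (m - 1)) * (fconst (q - 1) * ?T + fconst q) + ?S')"
    using step T S
    by (intro hecke_class_add_cong hecke_class_mult_cong hecke_class_quadratic refl) auto
  also have "fconst (q ^ (m - 1)) * (fconst (q - 1) * ?T + fconst q) + ?S' =
      fconst (q ^ m) + ?S (Suc m)"
  proof -
    have "fconst (q ^ (m - 1)) * fconst q = fconst (q ^ m)"
      using step by (cases m) (simp_all add: fconst_mult[symmetric] mult.commute)
    moreover have "?S (Suc m) = ?S' + ?c m * ?T"
      using step by (simp add: transposition_word_Suc_self)
    ultimately show ?thesis
      by (simp add: distrib_left fconst_mult[symmetric] mult.assoc[symmetric] mult.commute add_ac)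
  qed
  finally show ?case
    by simp
qed

lemma short_scan_eq_word:
  assumes "n \<ge> 1"
  shows "short_scan q n =
    hecke_class q n (fconst (q powi (- 2 * (int n - 1))) * word_product (rev [1..<n] @ [1..<n]))"
proof -
  let ?ws = "rev [1..<n] @ [1..<n]" and ?f = "\<lambda>i. fconst (inverse q) * fgen i"
  have "short_scan q n = list_mult (hecke_alg q n) (map (\<lambda>i. hecke_class q n (?f i)) ?ws)"
  proof -
    have "hecke_Ttilde q n (transpose i (i + 1)) = hecke_class q n (?f i)" if "i \<in> set ?ws" for i
      using that hecke_Ttilde_transpose[of i "Suc i" n q]
      by (simp add: transposition_word_Suc_self power_int_minus)
    then show ?thesis
      unfolding short_scan_def by (simp only: cong: map_cong)
  qed
  also have "\<dots> = hecke_class q n (prod_list (map ?f ?ws))"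
    by (rule conjunct1, rule list_mult_hecke_class) auto
  also have "prod_list (map ?f is) = fconst (inverse q ^ length is) * word_product is" for "is"
  proof (induction "is")
    case (Cons i "is")
    have "fgen i * (fconst c * word_product is) = fconst c * (fgen i * word_product is)" for c
      by (simp only: mult.assoc[symmetric] fconst_commute[of "fgen i"])
    with Cons show ?case
      by (simp add: fconst_mult mult.assoc)
  qed simp
  also have "inverse q ^ length ?ws = q powi (- 2 * (int n - 1))"
  proof -
    have "- 2 * (int n - 1) = - int (length ?ws)"
      using assms by simp
    then show ?thesis
      by (simp only: power_int_minus power_int_of_nat power_inverse)
  qed
  finally show ?thesis .
qed

lemma jucys_murphy_in_carrier:
  assumes "q \<noteq> 0" "m \<le> n"
  shows "jucys_murphy q n m \<in> carrier (hecke_alg q n)"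
  using assms by (simp add: jucys_murphy_eq)

lemma affine_jucys_murphy:
  assumes "q \<noteq> 0" "m \<le> n"
  shows "a \<odot>\<^bsub>hecke_alg q n\<^esub> (\<one>\<^bsub>hecke_alg q n\<^esub> \<oplus>\<^bsub>hecke_alg q n\<^esub>
      b \<odot>\<^bsub>hecke_alg q n\<^esub> jucys_murphy q n m) =
     a \<odot>\<^bsub>hecke_alg q n\<^esub> \<one>\<^bsub>hecke_alg q n\<^esub> \<oplus>\<^bsub>hecke_alg q n\<^esub> (a * b) \<odot>\<^bsub>hecke_alg q n\<^esub> jucys_murphy q n m"
  using assms by (simp add: jucys_murphy_eq one_hecke_alg hecke_class_smult hecke_class_add
     fconst_mult distrib_left mult.assoc)

lemma short_scan_eq:
  assumes "q \<noteq> 0" "n \<ge> 1"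
  shows "short_scan q n = (q powi (1 - int n)) \<odot>\<^bsub>hecke_alg q n\<^esub>
    (\<one>\<^bsub>hecke_alg q n\<^esub> \<oplus>\<^bsub>hecke_alg q n\<^esub> (q - 1) \<odot>\<^bsub>hecke_alg q n\<^esub> jucys_murphy q n n)"
proof -
  let ?W = "\<lambda>i. word_product (transposition_word i n)"
  let ?e = "q powi (- 2 * (int n - 1))" and ?d = "q powi (1 - int n)"
  let ?S = "\<Sum>i\<in>{1..<n}. fconst ((q - 1) * q ^ (i - 1)) * ?W i"
  let ?J = "jucys_murphy_lift q n"
  have W: "?W i \<in> free_carrier n" if "i \<in> {1..<n}" for i
    using that set_transposition_word[of i n n] by simp
  then have S: "?S \<in> free_carrier n"
    by (intro sum_in_free_carrier mult_in_free_carrier) simp_all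
  have "short_scan q n = hecke_class q n (fconst ?e * (fconst (q ^ (n - 1)) + ?S))"
    unfolding short_scan_eq_word[OF assms(2)]
    by (intro hecke_class_mult_cong scan_word_eq refl) (use assms S in auto)
  also have "fconst ?e * (fconst (q ^ (n - 1)) + ?S) = fconst ?d * (1 + fconst (q - 1) * ?J)"
  proof -
    have e: "?e * q ^ k = q powi (int k - 2 * (int n - 1))" for k
      using assms(1) by (simp add: power_int_add[symmetric] algebra_simps flip: power_int_of_nat)
    have "?e * q ^ (n - 1) = ?d"
      unfolding e using assms by (simp add: of_nat_diff)
    moreover have "?e * ((q - 1) * q ^ (i - 1)) = ?d * ((q - 1) * q powi (int i - int n))"
      if "i \<in> {1..<n}" for i
    proof -
      have "?e * q ^ (i - 1) = q powi ((1 - int n) + (int i - int n))"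
        unfolding e using that by (simp add: of_nat_diff algebra_simps)
      also have "\<dots> = ?d * q powi (int i - int n)"
        using assms by (intro power_int_add) simp
      finally show ?thesis
        by (simp add: mult.left_commute)
    qed
    then have "fconst ?e * (fconst ((q - 1) * q ^ (i - 1)) * ?W i) =
        fconst ?d * (fconst (q - 1) * (fconst (q powi (int i - int n)) * ?W i))"
      if "i \<in> {1..<n}" for i
      using that by (simp only: mult.assoc[symmetric] fconst_mult[symmetric])
    then have "fconst ?e * ?S = fconst ?d * (fconst (q - 1) * ?J)"
      by (simp add: jucys_murphy_lift_def sum_distrib_left)
    ultimately show ?thesis
      by (simp add: distrib_left fconst_mult[symmetric])
  qed
  finally show ?thesis
    using assms S by (simp add: jucys_murphy_eq one_hecke_alg hecke_class_smult hecke_class_add)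
qed

lemma qint_nonzero:
  fixes q :: real
  assumes "q > 1" "r > 0"
  shows "qint (complex_of_real q) r \<noteq> 0"
proof -
  have "q powi r > 1"
    using assms by (simp add: power_int_def one_less_power)
  then have "complex_of_real (q powi r) \<noteq> 1"
    by (simp only: of_real_eq_1_iff)
  then show ?thesis
    using assms by (simp add: qint_def)
qed

lemma star_shuffle_1_eq:
  assumes "q \<noteq> 0" "qint q (int n - 1) \<noteq> 0"
  shows "star_shuffle q n 1 = (1 / qint q (int n)) \<odot>\<^bsub>hecke_alg q n\<^esub>
    (\<one>\<^bsub>hecke_alg q n\<^esub> \<oplus>\<^bsub>hecke_alg q n\<^esub> q \<odot>\<^bsub>hecke_alg q n\<^esub> jucys_murphy q n n)"
proof -
  interpret abelian_monoid "hecke_alg q n"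
    by (rule abelian_monoid_hecke_alg)
  have "(\<Oplus>\<^bsub>hecke_alg q n\<^esub>l\<in>{1..1}. jucys_murphy q n (n + 1 - l)) = jucys_murphy q n n"
    using jucys_murphy_in_carrier[OF assms(1), of n n] by simp
  then show ?thesis
    using assms by (simp add: star_shuffle_def affine_jucys_murphy)
qed

lemma (in hecke_module) act_affine_jucys_murphy:
  assumes "q \<noteq> 0" "m \<le> n" "act (jucys_murphy q n m) x = scale c x"
  shows "act (a \<odot>\<^bsub>hecke_alg q n\<^esub> (\<one>\<^bsub>hecke_alg q n\<^esub> \<oplus>\<^bsub>hecke_alg q n\<^esub>
      b \<odot>\<^bsub>hecke_alg q n\<^esub> jucys_murphy q n m)) x = scale (a * (1 + b * c)) x"
proof -
  have "\<one>\<^bsub>hecke_alg q n\<^esub> \<in> carrier (hecke_alg q n)"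
      "b \<odot>\<^bsub>hecke_alg q n\<^esub> jucys_murphy q n m \<in> carrier (hecke_alg q n)"
      "\<one>\<^bsub>hecke_alg q n\<^esub> \<oplus>\<^bsub>hecke_alg q n\<^esub> b \<odot>\<^bsub>hecke_alg q n\<^esub> jucys_murphy q n m
        \<in> carrier (hecke_alg q n)"
    using assms by (simp_all add: jucys_murphy_eq one_hecke_alg hecke_class_smult hecke_class_add)
  then show ?thesis
    using jucys_murphy_in_carrier[OF assms(1,2)] assms(3)
    by (simp add: act_smult act_add act_one algebra_simps)
qed

theorem proposition3p11:
  fixes q :: real and Q :: complex and n :: nat
  assumes "q > 1" and "Q = complex_of_real q" and "n \<ge> 2"
  shows
    "star_shuffle Q n 1 =
       (1 / qint Q (int n)) \<odot>\<^bsub>hecke_alg Q n\<^esub>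
         (\<one>\<^bsub>hecke_alg Q n\<^esub> \<oplus>\<^bsub>hecke_alg Q n\<^esub> Q \<odot>\<^bsub>hecke_alg Q n\<^esub> jucys_murphy Q n n) \<and>
     short_scan Q n =
       (Q powi (1 - int n)) \<odot>\<^bsub>hecke_alg Q n\<^esub>
         (\<one>\<^bsub>hecke_alg Q n\<^esub> \<oplus>\<^bsub>hecke_alg Q n\<^esub> (Q - 1) \<odot>\<^bsub>hecke_alg Q n\<^esub> jucys_murphy Q n n) \<and>
     (\<forall>lam S (scale :: complex \<Rightarrow> 'v::ab_group_add \<Rightarrow> 'v) act v.
        is_partition lam n \<and> S \<in> SYT lam \<and> seminormal_module scale Q n act lam v \<longrightarrow>
          v S \<noteq> 0 \<and>
          act (star_shuffle Q n 1) (v S) =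
            scale (qint Q (content n S + 1) / qint Q (int n)) (v S) \<and>
          act (short_scan Q n) (v S) = scale (Q powi (content n S + 1 - int n)) (v S))"
proof -
  have Q: "Q \<noteq> 0" "Q \<noteq> 1"
    using assms(1,2) by simp_all
  have "qint Q (int n - 1) \<noteq> 0"
    using qint_nonzero assms by simp
  with Q(1) have star: "star_shuffle Q n 1 = (1 / qint Q (int n)) \<odot>\<^bsub>hecke_alg Q n\<^esub>
      (\<one>\<^bsub>hecke_alg Q n\<^esub> \<oplus>\<^bsub>hecke_alg Q n\<^esub> Q \<odot>\<^bsub>hecke_alg Q n\<^esub> jucys_murphy Q n n)"
    by (rule star_shuffle_1_eq)
  have scan: "short_scan Q n = (Q powi (1 - int n)) \<odot>\<^bsub>hecke_alg Q n\<^esub>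
      (\<one>\<^bsub>hecke_alg Q n\<^esub> \<oplus>\<^bsub>hecke_alg Q n\<^esub> (Q - 1) \<odot>\<^bsub>hecke_alg Q n\<^esub> jucys_murphy Q n n)"
    using Q(1) assms(3) by (intro short_scan_eq) auto
  have "v S \<noteq> 0 \<and>
      act (star_shuffle Q n 1) (v S) = scale (qint Q (content n S + 1) / qint Q (int n)) (v S) \<and>
      act (short_scan Q n) (v S) = scale (Q powi (content n S + 1 - int n)) (v S)"
    if S: "S \<in> SYT lam" and M: "seminormal_module scale Q n act lam v"
    for lam S v act and scale :: "complex \<Rightarrow> 'v \<Rightarrow> 'v"
  proof -
    interpret seminormal_module scale Q n act lam v by (rule M)
    let ?c = "content n S"
    note act_affine = act_affine_jucys_murphy[OF Q(1) order_refl
        jucys_murphy_act[OF S assms(3) order_refl]]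
    have "v S \<noteq> 0"
      using basis_independent S dependent_zero by force
    moreover have "1 + Q * qint Q ?c = qint Q (?c + 1)"
      using Q by (simp add: qint_def power_int_add field_simps)
    moreover have "Q powi (1 - int n) * (1 + (Q - 1) * qint Q ?c) = Q powi (?c + 1 - int n)"
    proof -
      have "1 + (Q - 1) * qint Q ?c = Q powi ?c"
        using Q(2) by (simp add: qint_def)
      then show ?thesis
        using Q(1) by (simp flip: power_int_add) (simp add: algebra_simps)
    qed
    ultimately show ?thesis
      unfolding star scan act_affine by simp
  qed
  with star scan show ?thesis
    by blast
qed

end
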